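(* Let $d \in \{1,3\}$ and $1 < p \leq \infty$. Then there are constants $D_1, D_2 > 0$ such that for all $u \in C_0^\infty(\mathbb{R}^d \setminus \{0\})$, $$\left( \int_{\mathbb{R}^d} |u(x)|^{2p} \, dx \right)^{\frac{1}{p}} \leq \int_{\mathbb{R}^d} \left( |\Delta u(x)|^2 - D_1 \frac{|u(x)|^2}{|x|^4} + D_2 |u(x)|^2 \right) dx,$$ where for $p = \infty$ the left-hand side is understood as $\sup_{x} |u(x)|^2$.
   Context: $C_0^\infty(\mathbb{R}^d \setminus \{0\})$ denotes the complex-valued smooth functions with compact support in $\mathbb{R}^d \setminus \{0\}$. For $d = 1$, $\Delta u = u''$. *)

theory Defs
  imports "HOL-Analysis.Analysis"
begin

definition dir_deriv :: "('a::real_normed_vector \<Rightarrow> 'b::real_normed_vector) \<Rightarrow> 'a \<Rightarrow> 'a \<Rightarrow> 'b" where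
  "dir_deriv f v = (\<lambda>x. frechet_derivative f (at x) v)"

fun C_k :: "nat \<Rightarrow> ('a::real_normed_vector \<Rightarrow> 'b::real_normed_vector) \<Rightarrow> bool" where
  "C_k 0 f \<longleftrightarrow> continuous_on UNIV f"
| "C_k (Suc k) f \<longleftrightarrow> (\<forall>x. f differentiable (at x)) \<and> (\<forall>v. C_k k (dir_deriv f v))"

definition smooth :: "('a::real_normed_vector \<Rightarrow> 'b::real_normed_vector) \<Rightarrow> bool" where
  "smooth f \<longleftrightarrow> (\<forall>k. C_k k f)"

text \<open>Smooth functions with compact support in an open set \<open>\<Omega>\<close>, identified with their
  extensions by zero to the whole space.\<close>

definition test_functions :: "'a::real_normed_vector set \<Rightarrow> ('a \<Rightarrow> complex) set" where
  "test_functions \<Omega> = {u. smooth u \<and> compact (closure (support_on UNIV u))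
                          \<and> closure (support_on UNIV u) \<subseteq> \<Omega>}"

definition laplacian :: "('a::euclidean_space \<Rightarrow> complex) \<Rightarrow> 'a \<Rightarrow> complex" where
  "laplacian u x = (\<Sum>b\<in>Basis. dir_deriv (dir_deriv u b) b x)"

lemma laplacian_real:
  fixes u :: "real \<Rightarrow> complex"
  assumes "smooth u"
  shows "laplacian u x = vector_derivative (\<lambda>y. vector_derivative u (at y)) (at x)"
proof -
  have "C_k (Suc (Suc 0)) u"
    using assms unfolding smooth_def by blast
  then have d: "\<And>y. u differentiable (at y)" and d2: "dir_deriv u 1 differentiable (at x)"
    by auto
  have 1: "dir_deriv u 1 = (\<lambda>y. vector_derivative u (at y))"
    unfolding dir_deriv_def using frechet_derivative_eq_vector_derivative[OF d] by simp
  show ?thesis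
    using frechet_derivative_eq_vector_derivative[OF d2]
    unfolding 1 by (simp add: laplacian_def 1) (simp add: dir_deriv_def)
qed

text \<open>The left-hand side, i.e. the square of the \<open>L\<close>-norm of \<open>u\<close> with exponent \<open>2p\<close>.\<close>

definition Lp_term :: "ereal \<Rightarrow> ('a::euclidean_space \<Rightarrow> complex) \<Rightarrow> real" where
  "Lp_term p u =
     (if p = \<infinity> then (SUP x. (cmod (u x))\<^sup>2)
      else (LINT x|lborel. cmod (u x) powr (2 * real_of_ereal p)) powr (1 / real_of_ereal p))"

end

theory Submission
  imports Defs
begin

text \<open>
  Write \<open>q = |x - a|\<^sup>2 + e\<close> and test \<open>|v|\<^sup>2\<close> against the divergence of the field
  \<open>(x - a) q\<^sup>-\<^sup>\<alpha>\<close>. With \<open>a = e = 0\<close> and \<open>\<alpha> = 2\<close>, then \<open>\<alpha> = 1\<close> for each partial derivative, this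
  gives Hardy inequalities which combine to a Rellich inequality, because two integrations by parts
  turn the squared norm of the Hessian into that of the Laplacian. With \<open>\<alpha>\<close> half the dimension \<open>d\<close>,
  the divergence is \<open>d e q\<^sup>-\<^sup>\<alpha>\<^sup>-\<^sup>1\<close>, a multiple of an approximate identity at \<open>a\<close>, so that letting \<open>e\<close>
  tend to 0 bounds \<open>|v(a)|\<^sup>2\<close> by an arbitrarily small multiple of \<open>\<parallel>\<Delta>v\<parallel>\<^sup>2\<close> plus a multiple of
  \<open>\<parallel>v\<parallel>\<^sup>2\<close>. Finally \<open>|u|\<^sup>2\<^sup>p\<close> integrates to at most
  \<open>(sup |u|\<^sup>2)\<^sup>p\<^sup>-\<^sup>1 \<parallel>u\<parallel>\<^sup>2 \<le> (sup |u|\<^sup>2 + \<parallel>u\<parallel>\<^sup>2)\<^sup>p\<close>.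
\<close>

section \<open>Integrals of compactly supported functions and of their line derivatives\<close>

lemma integrable_compact_support:
  fixes f :: "'a::euclidean_space \<Rightarrow> 'b::{banach, second_countable_topology}"
  assumes "compact K" "continuous_on K f" "\<And>x. x \<notin> K \<Longrightarrow> f x = 0"
  shows "integrable lborel f"
proof -
  have "f = (\<lambda>x. indicator K x *\<^sub>R f x)"
    using assms(3) by (auto simp: indicator_def fun_eq_iff)
  then show ?thesis
    using borel_integrable_compact[OF assms(1,2)] by simp
qed

lemma integral_lborel_translate:
  fixes f :: "'a::euclidean_space \<Rightarrow> real"
  assumes "f \<in> borel_measurable borel"
  shows "(LINT x|lborel. f (x + c)) = integral\<^sup>L lborel f"
proof -
  have "integral\<^sup>L lborel f = integral\<^sup>L (distr lborel borel ((+) c)) f"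
    by (simp only: lborel_distr_plus)
  also have "\<dots> = (LINT x|lborel. f (c + x))"
    using assms by (intro integral_distr) auto
  finally show ?thesis by (simp add: add.commute)
qed

text \<open>Translation invariance makes the integral of every difference quotient vanish, so no
  iterated integration is needed.\<close>

lemma integral_line_derivative_eq_0:
  fixes f g :: "'a::euclidean_space \<Rightarrow> real"
  assumes K: "compact K" and S: "open S" "K \<subseteq> S"
    and out: "\<And>x. x \<notin> K \<Longrightarrow> f x = 0" "\<And>x. x \<notin> K \<Longrightarrow> g x = 0"
    and cont: "continuous_on S f" "continuous_on S g"
    and der: "\<And>x. x \<in> S \<Longrightarrow> ((\<lambda>t. f (x + t *\<^sub>R b)) has_vector_derivative g x) (at 0)"
  shows "integral\<^sup>L lborel g = 0"
proof -
  have oK: "open (- K)" using K by (simp add: compact_imp_closed open_Compl)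
  \<comment> \<open>The open sets \<open>S\<close> and \<open>- K\<close> cover the space, so
    vanishing off \<open>K\<close> turns continuity on \<open>S\<close> into global continuity.
    Asking for regularity on \<open>S\<close> only admits weights that are singular outside
    \<open>S\<close>.\<close>
  have extend: "continuous_on UNIV h" if "\<And>x. x \<notin> K \<Longrightarrow> h x = 0" "continuous_on S h"
    for h :: "'a \<Rightarrow> real"
  proof -
    have "continuous_on (- K) h"
      using that(1) by (auto intro: continuous_on_eq[of _ "\<lambda>_. 0"])
    then have "continuous_on (S \<union> - K) h"
      using that(2) S(1) oK by (intro continuous_on_open_Un)
    moreover have "S \<union> - K = UNIV" using S(2) by auto
    ultimately show ?thesis by simp
  qed
  have cf: "continuous_on UNIV f" and cg: "continuous_on UNIV g"
    using extend out cont by blast+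
  have der0: "((\<lambda>t. f (x + t *\<^sub>R b)) has_vector_derivative g x) (at 0)" for x
  proof (cases "x \<in> S")
    case False
    then have x: "x \<in> - K" using S(2) by auto
    have "\<forall>\<^sub>F t in nhds 0. x + t *\<^sub>R b \<in> - K"
    proof -
      have "((\<lambda>t. x + t *\<^sub>R b) \<longlongrightarrow> x + 0 *\<^sub>R b) (nhds 0)"
        by (intro tendsto_intros filterlim_ident)
      then show ?thesis using topological_tendstoD[OF _ oK] x by fastforce
    qed
    then have "\<forall>\<^sub>F t in nhds 0. f (x + t *\<^sub>R b) = 0"
      by eventually_elim (use out in auto)
    then have "((\<lambda>t. f (x + t *\<^sub>R b)) has_vector_derivative 0) (at 0)"
      by (subst has_vector_derivative_cong_ev[where g = "\<lambda>_. 0"])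
         (use x out in auto)
    then show ?thesis using x out by simp
  qed (use der in blast)
  have der1: "((\<lambda>s. f (x + s *\<^sub>R b)) has_vector_derivative g (x + t *\<^sub>R b)) (at t)" for x t
  proof -
    have "((\<lambda>s. f ((x + t *\<^sub>R b) + s *\<^sub>R b)) has_field_derivative g (x + t *\<^sub>R b)) (at 0)"
      using der0[of "x + t *\<^sub>R b"] by (simp add: has_real_derivative_iff_has_vector_derivative)
    then have "((\<lambda>s. f (x + (s + t) *\<^sub>R b)) has_field_derivative g (x + t *\<^sub>R b)) (at 0)"
      by (simp add: scaleR_add_left add_ac)
    then have "((\<lambda>s. f (x + s *\<^sub>R b)) has_field_derivative g (x + t *\<^sub>R b)) (at (0 + t))"
      by (subst DERIV_shift)
    then show ?thesis by (simp add: has_real_derivative_iff_has_vector_derivative)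
  qed
  have "bounded (g ` K)"
    using K cg by (intro compact_imp_bounded compact_continuous_image)
      (auto intro: continuous_on_subset)
  then obtain M where M: "M > 0" "\<And>x. x \<in> K \<Longrightarrow> norm (g x) \<le> M"
    unfolding bounded_pos by auto
  have gM: "norm (g x) \<le> M" for x
    using M out(2)[of x] by (cases "x \<in> K") auto
  \<comment> \<open>By the mean value inequality all difference quotients are bounded by
    \<open>M\<close>, which supplies the dominating function below.\<close>
  have lip: "norm (f (x + t *\<^sub>R b) - f x) \<le> M * t" if "t > 0" for x t
  proof -
    have "norm (f (x + t *\<^sub>R b) - f (x + 0 *\<^sub>R b)) \<le> M * norm (t - 0)"
    proof (rule differentiable_bound[where f = "\<lambda>s. f (x + s *\<^sub>R b)" and S = UNIV
          and f' = "\<lambda>s h. h *\<^sub>R g (x + s *\<^sub>R b)"])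
      show "((\<lambda>s. f (x + s *\<^sub>R b)) has_derivative (\<lambda>h. h *\<^sub>R g (x + s *\<^sub>R b))) (at s within UNIV)"
        for s
        using der1[of x s] by (simp add: has_vector_derivative_def)
      show "onorm (\<lambda>h. h *\<^sub>R g (x + s *\<^sub>R b)) \<le> M" for s
        using gM[of "x + s *\<^sub>R b"] M(1)
        by (intro onorm_bound) (auto simp: abs_mult mult.commute[of M] mult_left_mono)
    qed auto
    then show ?thesis using that by simp
  qed
  obtain R where R: "\<And>x. x \<in> K \<Longrightarrow> norm x \<le> R"
    using compact_imp_bounded[OF K] unfolding bounded_iff by auto
  \<comment> \<open>The steps \<open>X n\<close> are at most 1, so every difference quotient
    \<open>s n\<close> vanishes outside this enlarged ball.\<close>
  let ?B = "cball (0::'a) (R + norm b)"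
  define X where "X n = inverse (real (Suc n))" for n
  have X: "0 < X n" "X n \<le> 1" for n by (auto simp: X_def field_simps)
  have Xlim: "X \<longlonglongrightarrow> 0" unfolding X_def by (rule LIMSEQ_inverse_real_of_nat)
  define s where "s n x = (f (x + X n *\<^sub>R b) - f x) / X n" for n x
  have fint: "integrable lborel f"
    using K continuous_on_subset[OF cf] out by (intro integrable_compact_support[of K]) auto
  have fmeas: "f \<in> borel_measurable borel" 
    using cf by (rule borel_measurable_continuous_onI)
  have "integrable lborel (\<lambda>x. f (x + c))" for c
  proof (rule integrable_compact_support[of "(\<lambda>x. x - c) ` K"])
    show "compact ((\<lambda>x. x - c) ` K)"
      using K by (intro compact_continuous_image continuous_intros)
    show "continuous_on ((\<lambda>x. x - c) ` K) (\<lambda>x. f (x + c))"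
      by (intro continuous_on_compose2[OF cf] continuous_intros) auto
    show "f (x + c) = 0" if "x \<notin> (\<lambda>x. x - c) ` K" for x
    proof (rule out)
      show "x + c \<notin> K" using that by (metis add_diff_cancel_right' image_eqI)
    qed
  qed
  then have "integral\<^sup>L lborel (s n) = 0" for n
    using fint integral_lborel_translate[OF fmeas, of "X n *\<^sub>R b"] by (simp add: s_def[abs_def])
  moreover have "(\<lambda>n. integral\<^sup>L lborel (s n)) \<longlonglongrightarrow> integral\<^sup>L lborel g"
  proof (rule integral_dominated_convergence[where w = "\<lambda>x. indicator ?B x *\<^sub>R M"])
    show "g \<in> borel_measurable lborel"
      using cg by (simp add: borel_measurable_continuous_onI)
    show "s n \<in> borel_measurable lborel" for n
    proof -
      have "continuous_on UNIV (s n)" unfolding s_def[abs_def] using X(1)[of n]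
        by (intro continuous_intros continuous_on_compose2[OF cf]) auto
      then show ?thesis by (simp add: borel_measurable_continuous_onI)
    qed
    show "integrable lborel (\<lambda>x. indicator ?B x *\<^sub>R M)"
      by (intro borel_integrable_compact) auto
    show "AE x in lborel. (\<lambda>i. s i x) \<longlonglongrightarrow> g x"
    proof (rule AE_I2)
      fix x
      have "((\<lambda>t. (f (x + t *\<^sub>R b) - f x) / t) \<longlongrightarrow> g x) (at 0)"
        using der0[of x] unfolding has_real_derivative_iff_has_vector_derivative[symmetric]
        by (simp add: has_field_derivative_iff)
      moreover have "filterlim X (at 0) sequentially"
        using Xlim X(1) by (simp add: filterlim_at less_imp_neq[symmetric])
      ultimately show "(\<lambda>i. s i x) \<longlonglongrightarrow> g x"
        unfolding s_def by (rule filterlim_compose)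
    qed
    show "AE x in lborel. norm (s n x) \<le> indicator ?B x *\<^sub>R M" for n
    proof (rule AE_I2)
      fix x
      show "norm (s n x) \<le> indicator ?B x *\<^sub>R M"
      proof (cases "x \<in> ?B")
        case True
        then show ?thesis using lip[OF X(1)[of n], of x] X(1)[of n]
          by (simp add: s_def field_simps)
      next
        case False
        then have nx: "norm x > R + norm b" by simp
        have "norm (X n *\<^sub>R b) \<le> norm b"
          using X(1,2)[of n] by (simp add: mult_left_le_one_le)
        then have "norm (x + X n *\<^sub>R b) > R"
          using nx norm_triangle_ineq4[of "x + X n *\<^sub>R b" "X n *\<^sub>R b"] by simp
        then have "x + X n *\<^sub>R b \<notin> K" using R by force
        moreover have "x \<notin> K" using nx R[of x] norm_ge_zero[of b] by linarith
        ultimately show ?thesis using out False by (simp add: s_def[abs_def])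
      qed
    qed
  qed
  ultimately show ?thesis by (simp add: LIMSEQ_const_iff)
qed

section \<open>Derivatives along lines and symmetry of mixed derivatives\<close>

lemma smooth_dir_deriv: "smooth u \<Longrightarrow> smooth (dir_deriv u b)"
  unfolding smooth_def by (metis C_k.simps(2))

lemma smooth_differentiable: "smooth u \<Longrightarrow> u differentiable (at x)"
  unfolding smooth_def by (metis C_k.simps(2))

lemma smooth_continuous_on: "smooth u \<Longrightarrow> continuous_on S u"
  unfolding smooth_def by (metis C_k.simps(1) continuous_on_subset subset_UNIV)

lemma smooth_line_derivative:
  assumes "smooth u"
  shows "((\<lambda>s. u (x + s *\<^sub>R b)) has_vector_derivative dir_deriv u b (x + t *\<^sub>R b)) (at t within A)"
proof -
  let ?D = "frechet_derivative u (at (x + t *\<^sub>R b))"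
  have D: "(u has_derivative ?D) (at (x + t *\<^sub>R b))"
    using smooth_differentiable[OF assms] by (simp add: frechet_derivative_works)
  then have lin: "linear ?D" by (rule has_derivative_linear)
  have "((\<lambda>s. x + s *\<^sub>R b) has_derivative (\<lambda>h. h *\<^sub>R b)) (at t within A)"
    by (auto intro!: derivative_eq_intros)
  from has_derivative_compose[OF this D]
  show ?thesis
    by (simp add: has_vector_derivative_def dir_deriv_def linear_cmul[OF lin])
qed

lemma dir_deriv_eq_0_outside:
  assumes "closed K" "\<And>x. x \<notin> K \<Longrightarrow> u x = 0" "x \<notin> K"
  shows "dir_deriv u b x = 0"
proof -
  have "(u has_derivative (\<lambda>_. 0)) (at x)"
    by (rule has_derivative_transform_within_open[where f = "\<lambda>_. 0" and s = "- K"])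
       (use assms in auto)
  then show ?thesis
    by (simp add: dir_deriv_def frechet_derivative_at[symmetric])
qed

text \<open>The second difference of \<open>u\<close> is symmetric in the two directions, and divided by \<open>h\<^sup>2\<close> it
  tends to either mixed derivative.\<close>

lemma second_difference_bound:
  fixes u :: "'a::real_normed_vector \<Rightarrow> 'b::real_normed_vector"
  assumes u: "smooth u" and \<epsilon>: "\<epsilon> > 0"
  shows "\<exists>r>0. \<forall>h. 0 < h \<and> h < r \<longrightarrow>
    norm (u (x + h *\<^sub>R b + h *\<^sub>R c) - u (x + h *\<^sub>R b) - u (x + h *\<^sub>R c) + u x
      - h\<^sup>2 *\<^sub>R dir_deriv (dir_deriv u b) c x) \<le> \<epsilon> * h\<^sup>2"
proof -
  let ?w = "dir_deriv (dir_deriv u b) c"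
  have "continuous_on UNIV ?w"
    using u by (intro smooth_continuous_on smooth_dir_deriv)
  then obtain \<delta> where \<delta>: "\<delta> > 0" "\<And>y. dist y x < \<delta> \<Longrightarrow> dist (?w y) (?w x) < \<epsilon>"
    using \<epsilon> unfolding continuous_on_iff by (metis UNIV_I)
  \<comment> \<open>Chosen so that for \<open>h < r\<close> the whole parallelogram spanned by
    \<open>h *\<^sub>R b\<close> and \<open>h *\<^sub>R c\<close> at \<open>x\<close> lies in the
    \<open>\<delta>\<close>-ball; the added 1 keeps the denominator positive when both directions
    vanish.\<close>
  define r where "r = \<delta> / (norm b + norm c + 1)"
  have r: "r > 0" using \<delta>(1) by (simp add: r_def add_nonneg_pos)
  have close: "norm (?w (x + s *\<^sub>R b + t *\<^sub>R c) - ?w x) \<le> \<epsilon>"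
    if "0 \<le> s" "s \<le> h" "0 \<le> t" "t \<le> h" "h < r" for s t h
  proof -
    have "norm (s *\<^sub>R b + t *\<^sub>R c) \<le> s * norm b + t * norm c"
      using that by (metis abs_of_nonneg norm_scaleR norm_triangle_ineq)
    also have "\<dots> \<le> h * norm b + h * norm c"
      using that by (intro add_mono mult_right_mono) auto
    also have "\<dots> \<le> h * (norm b + norm c + 1)"
      using that by (simp add: algebra_simps)
    also have "\<dots> < r * (norm b + norm c + 1)"
      using that by (intro mult_strict_right_mono) (auto simp: add_nonneg_pos)
    also have "\<dots> = \<delta>"
      unfolding r_def by (metis add_nonneg_pos norm_ge_zero add_nonneg_nonneg zero_less_one less_irrefl nonzero_eq_divide_eq)
    finally have "dist (x + s *\<^sub>R b + t *\<^sub>R c) x < \<delta>" by (simp add: dist_norm add.assoc)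
    from \<delta>(2)[OF this] show ?thesis by (simp add: dist_norm)
  qed
  have "norm (u (x + h *\<^sub>R b + h *\<^sub>R c) - u (x + h *\<^sub>R b) - u (x + h *\<^sub>R c) + u x
      - h\<^sup>2 *\<^sub>R ?w x) \<le> \<epsilon> * h\<^sup>2" if h: "0 < h" "h < r" for h
  proof -
    \<comment> \<open>The mean value inequality is applied twice: first to
      \<open>dir_deriv u b\<close> in direction \<open>c\<close>, then, with this bound as
      derivative bound, in direction \<open>b\<close> to the first difference of \<open>u\<close> in
      direction \<open>c\<close>.\<close>
    have inner: "norm (dir_deriv u b (x + s *\<^sub>R b + h *\<^sub>R c) - dir_deriv u b (x + s *\<^sub>R b) - h *\<^sub>R ?w x)
        \<le> \<epsilon> * h" if s: "0 \<le> s" "s \<le> h" for s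
    proof -
      let ?g = "\<lambda>t. dir_deriv u b (x + s *\<^sub>R b + t *\<^sub>R c) - t *\<^sub>R ?w x"
      have "norm (?g h - ?g 0) \<le> \<epsilon> * norm (h - 0)"
      proof (rule differentiable_bound[where S = "{0..h}"
            and f' = "\<lambda>t k. k *\<^sub>R (?w (x + s *\<^sub>R b + t *\<^sub>R c) - ?w x)"])
        fix t assume t: "t \<in> {0..h}"
        have "(?g has_vector_derivative ?w (x + s *\<^sub>R b + t *\<^sub>R c) - ?w x) (at t within {0..h})"
          by (auto intro!: derivative_eq_intros smooth_line_derivative smooth_dir_deriv u)
        then show "(?g has_derivative (\<lambda>k. k *\<^sub>R (?w (x + s *\<^sub>R b + t *\<^sub>R c) - ?w x)))
            (at t within {0..h})"
          by (simp add: has_vector_derivative_def)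
        show "onorm (\<lambda>k. k *\<^sub>R (?w (x + s *\<^sub>R b + t *\<^sub>R c) - ?w x)) \<le> \<epsilon>"
          using close[of s h t] s t h \<epsilon>
          by (intro onorm_bound) (auto simp: mult.commute[of \<epsilon>] mult_left_mono)
      qed (use h in auto)
      then show ?thesis using h by (simp add: algebra_simps)
    qed
    let ?g = "\<lambda>s. u (x + h *\<^sub>R c + s *\<^sub>R b) - u (x + s *\<^sub>R b) - (s * h) *\<^sub>R ?w x"
    let ?g' = "\<lambda>s. dir_deriv u b (x + h *\<^sub>R c + s *\<^sub>R b) - dir_deriv u b (x + s *\<^sub>R b) - h *\<^sub>R ?w x"
    have "norm (?g h - ?g 0) \<le> (\<epsilon> * h) * norm (h - 0)"
    proof (rule differentiable_bound[where S = "{0..h}" and f' = "\<lambda>s k. k *\<^sub>R ?g' s"])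
      fix s assume s: "s \<in> {0..h}"
      have "(?g has_vector_derivative ?g' s) (at s within {0..h})"
        by (auto intro!: derivative_eq_intros smooth_line_derivative u)
      then show "(?g has_derivative (\<lambda>k. k *\<^sub>R ?g' s)) (at s within {0..h})"
        by (simp add: has_vector_derivative_def)
      show "onorm (\<lambda>k. k *\<^sub>R ?g' s) \<le> \<epsilon> * h"
        using inner[of s] s h \<epsilon>
        by (intro onorm_bound) (auto simp: mult.commute[of "\<epsilon> * h"] mult_left_mono add_ac)
    qed (use h in auto)
    then show ?thesis using h by (simp add: algebra_simps power2_eq_square)
  qed
  then show ?thesis using r by blast
qed

lemma smooth_dir_deriv_commute:
  fixes u :: "'a::real_normed_vector \<Rightarrow> 'b::real_normed_vector"
  assumes u: "smooth u"
  shows "dir_deriv (dir_deriv u b) c = dir_deriv (dir_deriv u c) b"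
proof (rule ext, rule ccontr)
  fix x
  let ?p = "dir_deriv (dir_deriv u b) c x" and ?q = "dir_deriv (dir_deriv u c) b x"
  assume "?p \<noteq> ?q"
  \<comment> \<open>The two approximation errors add up to \<open>2 * \<epsilon>\<close>, strictly
    less than the assumed gap \<open>3 * \<epsilon>\<close>.\<close>
  define \<epsilon> where "\<epsilon> = norm (?p - ?q) / 3"
  have \<epsilon>: "\<epsilon> > 0" using \<open>?p \<noteq> ?q\<close> by (simp add: \<epsilon>_def)
  define D where "D h = u (x + h *\<^sub>R b + h *\<^sub>R c) - u (x + h *\<^sub>R b) - u (x + h *\<^sub>R c) + u x" for h
  obtain r1 where r1: "r1 > 0" "\<And>h. 0 < h \<Longrightarrow> h < r1 \<Longrightarrow> norm (D h - h\<^sup>2 *\<^sub>R ?p) \<le> \<epsilon> * h\<^sup>2"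
    using second_difference_bound[OF u \<epsilon>, of x b c] unfolding D_def by blast
  have D': "D h = u (x + h *\<^sub>R c + h *\<^sub>R b) - u (x + h *\<^sub>R c) - u (x + h *\<^sub>R b) + u x" for h
    by (simp add: D_def add_ac)
  obtain r2 where r2: "r2 > 0" "\<And>h. 0 < h \<Longrightarrow> h < r2 \<Longrightarrow> norm (D h - h\<^sup>2 *\<^sub>R ?q) \<le> \<epsilon> * h\<^sup>2"
    using second_difference_bound[OF u \<epsilon>, of x c b] unfolding D' by blast
  define h where "h = min r1 r2 / 2"
  have h: "0 < h" "h < r1" "h < r2" using r1(1) r2(1) by (auto simp: h_def)
  have "h\<^sup>2 * norm (?p - ?q) = norm ((D h - h\<^sup>2 *\<^sub>R ?q) - (D h - h\<^sup>2 *\<^sub>R ?p))"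
    by (simp flip: scaleR_diff_right)
  also have "\<dots> \<le> \<epsilon> * h\<^sup>2 + \<epsilon> * h\<^sup>2"
    by (rule order_trans[OF norm_triangle_ineq4 add_mono[OF r2(2)[OF h(1,3)] r1(2)[OF h(1,2)]]])
  finally have "h\<^sup>2 * norm (?p - ?q) \<le> h\<^sup>2 * (2 * \<epsilon>)"
    by (simp add: mult_ac)
  then have "norm (?p - ?q) \<le> 2 * \<epsilon>" using h(1) by simp
  then show False using \<epsilon> by (simp add: \<epsilon>_def)
qed

section \<open>Integration by parts and weighted square integrals\<close>

text \<open>The integrand is the derivative in direction \<open>b\<close> of
  \<open>\<phi> x * (u x \<bullet> v x)\<close>. Since only a neighbourhood \<open>S\<close> of the
  support matters, \<open>\<phi>\<close> may be a negative power that is singular elsewhere.\<close>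

lemma integration_by_parts:
  fixes u v :: "'a::euclidean_space \<Rightarrow> 'b::real_inner" and \<phi> \<phi>' :: "'a \<Rightarrow> real"
  assumes u: "smooth u" and v: "smooth v"
    and K: "compact K" and S: "open S" "K \<subseteq> S" and out: "\<And>x. x \<notin> K \<Longrightarrow> u x = 0"
    and cont: "continuous_on S \<phi>" "continuous_on S \<phi>'"
    and der: "\<And>x. x \<in> S \<Longrightarrow> ((\<lambda>t. \<phi> (x + t *\<^sub>R b)) has_vector_derivative \<phi>' x) (at 0)"
  shows "(LINT x|lborel. \<phi>' x * (u x \<bullet> v x) +
      \<phi> x * (dir_deriv u b x \<bullet> v x + u x \<bullet> dir_deriv v b x)) = 0"
proof (rule integral_line_derivative_eq_0[OF K S, where f = "\<lambda>x. \<phi> x * (u x \<bullet> v x)"])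
  note [continuous_intros] = cont smooth_continuous_on[OF u] smooth_continuous_on[OF v]
    smooth_continuous_on[OF smooth_dir_deriv[OF u]] smooth_continuous_on[OF smooth_dir_deriv[OF v]]
  show "continuous_on S (\<lambda>x. \<phi> x * (u x \<bullet> v x))"
    "continuous_on S (\<lambda>x. \<phi>' x * (u x \<bullet> v x) +
      \<phi> x * (dir_deriv u b x \<bullet> v x + u x \<bullet> dir_deriv v b x))"
    by (intro continuous_intros)+
  show "\<phi> x * (u x \<bullet> v x) = 0" if "x \<notin> K" for x using out that by simp
  show "\<phi>' x * (u x \<bullet> v x) + \<phi> x * (dir_deriv u b x \<bullet> v x + u x \<bullet> dir_deriv v b x) = 0"
    if "x \<notin> K" for x
    using out that dir_deriv_eq_0_outside[OF compact_imp_closed[OF K] out] by simp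
  fix x assume x: "x \<in> S"
  have *: "((\<lambda>t. u (x + t *\<^sub>R b) \<bullet> v (x + t *\<^sub>R b)) has_vector_derivative
      u (x + 0 *\<^sub>R b) \<bullet> dir_deriv v b (x + 0 *\<^sub>R b) + dir_deriv u b (x + 0 *\<^sub>R b) \<bullet> v (x + 0 *\<^sub>R b)) (at 0)"
    by (intro bounded_bilinear.has_vector_derivative[OF bounded_bilinear_inner]
        smooth_line_derivative u v)
  show "((\<lambda>t. \<phi> (x + t *\<^sub>R b) * (u (x + t *\<^sub>R b) \<bullet> v (x + t *\<^sub>R b))) has_vector_derivative
      \<phi>' x * (u x \<bullet> v x) + \<phi> x * (dir_deriv u b x \<bullet> v x + u x \<bullet> dir_deriv v b x)) (at 0)"
    using has_vector_derivative_mult[OF der[OF x] *] by (simp add: algebra_simps)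
qed

text \<open>For \<open>a = 0\<close> and \<open>e = 0\<close> the weight is the power -2w of the
  distance to the origin, so \<open>w = 1\<close> is the Hardy weight and \<open>w = 2\<close> the
  Rellich weight. A positive \<open>e\<close> removes the singularity at \<open>a\<close>.\<close>

definition weighted_L2 :: "'a::euclidean_space \<Rightarrow> real \<Rightarrow> real \<Rightarrow> ('a \<Rightarrow> 'b::real_normed_vector) \<Rightarrow> real"
  where "weighted_L2 a e w v = (LINT x|lborel. ((norm (x - a))\<^sup>2 + e) powr (- w) * (norm (v x))\<^sup>2)"

lemma weighted_L2_nonneg: "0 \<le> weighted_L2 a e w v"
  unfolding weighted_L2_def by (intro Bochner_Integration.integral_nonneg) auto

text \<open>\<open>K\<close> is any compact set containing the support, so that \<open>v\<close> and
  all its derivatives are instances with the same \<open>K\<close>.\<close>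

locale smooth_supported =
  fixes v :: "'a::euclidean_space \<Rightarrow> 'b::real_inner" and K
  assumes smooth: "smooth v" and compact: "compact K" and outside: "\<And>x. x \<notin> K \<Longrightarrow> v x = 0"
begin

lemma dir_deriv_outside: "x \<notin> K \<Longrightarrow> dir_deriv v b x = 0"
  by (rule dir_deriv_eq_0_outside[OF compact_imp_closed[OF compact]]) (auto simp: outside)

lemma continuous [continuous_intros]: "continuous_on S v"
  using smooth by (rule smooth_continuous_on)

lemma continuous_dir_deriv [continuous_intros]: "continuous_on S (dir_deriv v b)"
  using smooth by (intro smooth_continuous_on smooth_dir_deriv)

lemma dir_deriv_supported: "smooth_supported (dir_deriv v b) K"
  by standard (auto simp: smooth_dir_deriv smooth compact dir_deriv_outside)

lemma integrable_norm_sq: "integrable lborel (\<lambda>x. (norm (v x))\<^sup>2)"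
  by (rule integrable_compact_support[OF compact])
     (auto intro!: continuous_intros simp: outside)

lemma integrable_inner:
  assumes "smooth_supported w K"
  shows "integrable lborel (\<lambda>x. v x \<bullet> w x)"
  by (rule integrable_compact_support[OF compact])
     (auto intro!: continuous_intros smooth_supported.continuous[OF assms] simp: outside)

text \<open>Positivity on \<open>K\<close> matters because \<open>0 powr 0 = 0\<close>: it makes the
  weight equal to 1 wherever \<open>v\<close> can be nonzero.\<close>

lemma weighted_L2_0:
  assumes "\<forall>x\<in>K. 0 < (norm (x - a))\<^sup>2 + e"
  shows "weighted_L2 a e 0 v = (LINT x|lborel. (norm (v x))\<^sup>2)"
  unfolding weighted_L2_def
proof (intro Bochner_Integration.integral_cong refl)
  fix x
  show "((norm (x - a))\<^sup>2 + e) powr - 0 * (norm (v x))\<^sup>2 = (norm (v x))\<^sup>2"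
    using bspec[OF assms, of x] outside[of x] by (cases "x \<in> K") auto
qed

lemma integrable_weighted_L2:
  assumes "\<forall>x\<in>K. 0 < (norm (x - a))\<^sup>2 + e"
  shows "integrable lborel (\<lambda>x. ((norm (x - a))\<^sup>2 + e) powr s * (norm (v x))\<^sup>2)"
  by (rule integrable_compact_support[OF compact])
     (use assms in \<open>auto intro!: continuous_intros simp: outside\<close>)

end

section \<open>Testing against the divergence of a radial field\<close>

text \<open>Along a line in direction \<open>b\<close> the base of the power is a quadratic
  polynomial in \<open>t\<close>, with derivative \<open>2 * ((x - a) \<bullet> b)\<close> at 0. The
  result is one summand of the divergence of the radial field.\<close>

lemma radial_field_line_derivative:
  fixes a b :: "'a::euclidean_space"
  assumes b: "b \<in> Basis" and q: "0 < (norm (x - a))\<^sup>2 + e"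
  shows "((\<lambda>t. ((x + t *\<^sub>R b - a) \<bullet> b) * ((norm (x + t *\<^sub>R b - a))\<^sup>2 + e) powr (- \<alpha>))
    has_vector_derivative ((norm (x - a))\<^sup>2 + e) powr (- \<alpha>)
      - 2 * \<alpha> * ((x - a) \<bullet> b)\<^sup>2 * ((norm (x - a))\<^sup>2 + e) powr (- \<alpha> - 1)) (at 0)"
proof -
  define y where "y = (x - a) \<bullet> b"
  have 1: "(x + t *\<^sub>R b - a) \<bullet> b = y + t" for t
    using b by (simp add: y_def inner_simps)
  have 2: "(norm (x + t *\<^sub>R b - a))\<^sup>2 + e = (norm (x - a))\<^sup>2 + 2 * t * y + t\<^sup>2 + e" for t
  proof -
    have "x + t *\<^sub>R b - a = (x - a) + t *\<^sub>R b" by simp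
    then show ?thesis using b unfolding y_def
      by (simp only: power2_norm_eq_inner)
         (simp add: inner_simps inner_commute algebra_simps power2_eq_square)
  qed
  let ?Q = "\<lambda>t. (norm (x - a))\<^sup>2 + 2 * t * y + t\<^sup>2 + e"
  have "(?Q has_field_derivative 2 * y) (at 0)"
    by (auto intro!: derivative_eq_intros)
  then have "((\<lambda>t. ?Q t powr (- \<alpha>)) has_field_derivative
      - \<alpha> * ?Q 0 powr (- \<alpha> - of_nat 1) * (2 * y)) (at 0)"
    by (rule DERIV_fun_powr) (use q in simp)
  then have "((\<lambda>t. (y + t) * ?Q t powr (- \<alpha>)) has_field_derivative
      (y + 0) * (- \<alpha> * ?Q 0 powr (- \<alpha> - of_nat 1) * (2 * y)) + (0 + 1) * ?Q 0 powr (- \<alpha>)) (at 0)"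
    by (intro DERIV_mult' DERIV_add DERIV_const DERIV_ident)
  then show ?thesis
    unfolding 1 2 y_def[symmetric] has_real_derivative_iff_has_vector_derivative[symmetric]
    by (simp add: algebra_simps power2_eq_square)
qed

text \<open>With q for the regularized squared distance, the squared norm of \<open>x - a\<close> is
  \<open>q - e\<close>. The divergence of the field is therefore \<open>(d - 2 * \<alpha>) * q powr
  (- \<alpha>) + 2 * \<alpha> * e * q powr (- \<alpha> - 1)\<close>, and integrating by parts moves
  the derivatives onto \<open>v\<close>.\<close>

lemma (in smooth_supported) radial_identity:
  fixes \<alpha> :: real
  assumes q: "\<forall>x\<in>K. 0 < (norm (x - a))\<^sup>2 + e"
  shows "integrable lborel (\<lambda>x. 2 * ((norm (x - a))\<^sup>2 + e) powr (- \<alpha>) *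
        (\<Sum>b\<in>Basis. ((x - a) \<bullet> b) * (v x \<bullet> dir_deriv v b x)))" (is "integrable _ ?R")
    and "(DIM('a) - 2 * \<alpha>) * weighted_L2 a e \<alpha> v + 2 * \<alpha> * e * weighted_L2 a e (\<alpha> + 1) v
      = - (LINT x|lborel. 2 * ((norm (x - a))\<^sup>2 + e) powr (- \<alpha>) *
        (\<Sum>b\<in>Basis. ((x - a) \<bullet> b) * (v x \<bullet> dir_deriv v b x)))"
proof -
  let ?q = "\<lambda>x. (norm (x - a))\<^sup>2 + e"
  \<comment> \<open>For \<open>e = 0\<close> this is the complement of \<open>a\<close>; for
    \<open>e > 0\<close> it is the whole space.\<close>
  define S where "S = {x. 0 < ?q x}"
  have S: "open S" "K \<subseteq> S"
    unfolding S_def using q by (auto intro!: open_Collect_less continuous_intros)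
  have [continuous_intros]: "continuous_on S (\<lambda>x. ?q x powr s)" for s
    by (intro continuous_intros) (auto simp: S_def)
  define \<phi> where "\<phi> b x = ((x - a) \<bullet> b) * ?q x powr (- \<alpha>)" for b x
  define \<phi>' where "\<phi>' b x = ?q x powr (- \<alpha>) - 2 * \<alpha> * ((x - a) \<bullet> b)\<^sup>2 * ?q x powr (- \<alpha> - 1)" for b x
  have c: "continuous_on S (\<phi> b)" "continuous_on S (\<phi>' b)" for b
    unfolding \<phi>_def \<phi>'_def by (intro continuous_intros)+
  let ?h = "\<lambda>b x. \<phi>' b x * (v x \<bullet> v x) + \<phi> b x * (dir_deriv v b x \<bullet> v x + v x \<bullet> dir_deriv v b x)"
  have "(LINT x|lborel. ?h b x) = 0" if "b \<in> Basis" for b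
  proof (rule integration_by_parts[OF smooth smooth compact S outside c])
    fix x assume "x \<in> S"
    then show "((\<lambda>t. \<phi> b (x + t *\<^sub>R b)) has_vector_derivative \<phi>' b x) (at 0)"
      unfolding \<phi>_def \<phi>'_def using radial_field_line_derivative[OF that] by (simp add: S_def)
  qed
  moreover have "integrable lborel (?h b)" for b
    by (rule integrable_compact_support[OF compact continuous_on_subset[OF _ S(2)]])
       (intro continuous_intros c, simp add: outside dir_deriv_outside)
  ultimately have sum0: "(LINT x|lborel. (\<Sum>b\<in>Basis. ?h b x)) = 0"
    by simp
  show R: "integrable lborel ?R"
    by (rule integrable_compact_support[OF compact continuous_on_subset[OF _ S(2)]])
       (intro continuous_intros, simp add: outside)
  have eq: "(\<Sum>b\<in>Basis. ?h b x) = (DIM('a) - 2 * \<alpha>) * (?q x powr (- \<alpha>) * (norm (v x))\<^sup>2)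
      + 2 * \<alpha> * e * (?q x powr (- (\<alpha> + 1)) * (norm (v x))\<^sup>2) + ?R x" for x
  proof (cases "x \<in> K")
    case False
    then show ?thesis by (simp add: outside dir_deriv_outside)
  next
    case True
    define Q where "Q = ?q x powr (- \<alpha> - 1)"
    have qp: "?q x powr (- \<alpha>) = ?q x * Q"
      using bspec[OF q True] powr_add[of "?q x" 1 "- \<alpha> - 1"] by (simp add: Q_def)
    have n: "(norm (x - a))\<^sup>2 = (\<Sum>b\<in>Basis. ((x - a) \<bullet> b)\<^sup>2)"
      unfolding power2_norm_eq_inner by (subst euclidean_inner) (simp add: power2_eq_square)
    have "(\<Sum>b\<in>Basis. \<phi>' b x) = DIM('a) * (?q x * Q) - 2 * \<alpha> * (norm (x - a))\<^sup>2 * Q"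
      unfolding \<phi>'_def qp Q_def[symmetric]
      by (simp only: sum_subtractf sum_constant n flip: sum_distrib_left sum_distrib_right)
    then have "(\<Sum>b\<in>Basis. \<phi>' b x * (v x \<bullet> v x)) =
        (DIM('a) * (?q x * Q) - 2 * \<alpha> * (norm (x - a))\<^sup>2 * Q) * (norm (v x))\<^sup>2"
      by (simp add: power2_norm_eq_inner flip: sum_distrib_right)
    moreover have "(\<Sum>b\<in>Basis. \<phi> b x * (dir_deriv v b x \<bullet> v x + v x \<bullet> dir_deriv v b x)) = ?R x"
      unfolding \<phi>_def by (simp add: sum_distrib_left inner_commute mult_ac)
    moreover have "?q x powr (- (\<alpha> + 1)) = Q" by (simp add: Q_def)
    ultimately show ?thesis unfolding sum.distrib qp by (simp add: algebra_simps)
  qed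
  have I: "integrable lborel (\<lambda>x. ?q x powr s * (norm (v x))\<^sup>2)" for s
    using integrable_weighted_L2[OF q] .
  show "(DIM('a) - 2 * \<alpha>) * weighted_L2 a e \<alpha> v + 2 * \<alpha> * e * weighted_L2 a e (\<alpha> + 1) v
      = - integral\<^sup>L lborel ?R"
    using sum0 R I[of "- \<alpha>"] I[of "- (\<alpha> + 1)"] unfolding eq weighted_L2_def by simp
qed

text \<open>Young's inequality in each coordinate, with the power of q shared between the two
  factors. Bounding the squared norm of \<open>y\<close> by q uses up one power of q, which is the 1
  in the relation between \<open>w\<close>, \<open>m\<close> and \<open>\<alpha>\<close>.\<close>

lemma radial_term_bound:
  fixes y :: "'a::euclidean_space" and v :: "'b::real_inner"
  assumes q: "0 < (norm y)\<^sup>2 + e" and e: "0 \<le> e" and \<theta>: "0 < \<theta>" and wm: "w + m = 2 * \<alpha> - 1"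
  shows "\<bar>2 * ((norm y)\<^sup>2 + e) powr (- \<alpha>) * (\<Sum>b\<in>Basis. (y \<bullet> b) * (v \<bullet> g b))\<bar>
    \<le> \<theta> * (((norm y)\<^sup>2 + e) powr (- w) * (norm v)\<^sup>2)
      + 1 / \<theta> * (\<Sum>b\<in>Basis. ((norm y)\<^sup>2 + e) powr (- m) * (norm (g b))\<^sup>2)"
proof -
  define q where "q = (norm y)\<^sup>2 + e"
  have q0: "0 < q" using q by (simp add: q_def)
  have one: "\<bar>2 * q powr (- \<alpha>) * ((y \<bullet> b) * (v \<bullet> g b))\<bar>
      \<le> \<theta> * (q powr (m - 2 * \<alpha>) * (y \<bullet> b)\<^sup>2 * (norm v)\<^sup>2) + 1 / \<theta> * (q powr (- m) * (norm (g b))\<^sup>2)"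
    for b
  proof -
    \<comment> \<open>The exponents of \<open>A\<close> and \<open>B\<close> add up to
      \<open>- \<alpha>\<close>, and squaring \<open>B\<close> leaves exactly the weight
      \<open>- m\<close> on the gradient.\<close>
    define A where "A = q powr (m / 2 - \<alpha>) * \<bar>y \<bullet> b\<bar> * norm v"
    define B where "B = q powr (- m / 2) * norm (g b)"
    have "\<bar>2 * q powr (- \<alpha>) * ((y \<bullet> b) * (v \<bullet> g b))\<bar>
        \<le> 2 * q powr (- \<alpha>) * (\<bar>y \<bullet> b\<bar> * (norm v * norm (g b)))"
      by (simp add: abs_mult mult_left_mono Cauchy_Schwarz_ineq2)
    also have "\<dots> = 2 * A * B"
    proof -
      have "q powr (- \<alpha>) = q powr (m / 2 - \<alpha>) * q powr (- m / 2)"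
        by (simp flip: powr_add)
      then show ?thesis by (simp add: A_def B_def mult_ac)
    qed
    also have "2 * A * B \<le> \<theta> * A\<^sup>2 + 1 / \<theta> * B\<^sup>2"
    proof -
      have "0 \<le> (\<theta> * A - B)\<^sup>2 / \<theta>" using \<theta> by simp
      also have "\<dots> = \<theta> * A\<^sup>2 + 1 / \<theta> * B\<^sup>2 - 2 * A * B"
        using \<theta> by (simp add: power2_eq_square field_simps)
      finally show ?thesis by simp
    qed
    also have "A\<^sup>2 = q powr (m - 2 * \<alpha>) * (y \<bullet> b)\<^sup>2 * (norm v)\<^sup>2"
      unfolding A_def power_mult_distrib by (simp add: power2_eq_square flip: powr_add)
    also have "B\<^sup>2 = q powr (- m) * (norm (g b))\<^sup>2"
      unfolding B_def power_mult_distrib by (simp add: power2_eq_square flip: powr_add)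
    finally show ?thesis .
  qed
  have n: "(norm y)\<^sup>2 = (\<Sum>b\<in>Basis. (y \<bullet> b)\<^sup>2)"
    unfolding power2_norm_eq_inner by (subst euclidean_inner) (simp add: power2_eq_square)
  have "\<bar>2 * q powr (- \<alpha>) * (\<Sum>b\<in>Basis. (y \<bullet> b) * (v \<bullet> g b))\<bar>
      \<le> (\<Sum>b\<in>Basis. \<theta> * (q powr (m - 2 * \<alpha>) * (y \<bullet> b)\<^sup>2 * (norm v)\<^sup>2)
        + 1 / \<theta> * (q powr (- m) * (norm (g b))\<^sup>2))"
    unfolding sum_distrib_left by (rule order_trans[OF sum_abs sum_mono[OF one]])
  also have "\<dots> = \<theta> * (q powr (m - 2 * \<alpha>) * (norm y)\<^sup>2 * (norm v)\<^sup>2)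
      + 1 / \<theta> * (\<Sum>b\<in>Basis. q powr (- m) * (norm (g b))\<^sup>2)"
    unfolding n sum.distrib by (simp add: sum_distrib_left sum_distrib_right)
  also have "\<dots> \<le> \<theta> * (q powr (m - 2 * \<alpha>) * q * (norm v)\<^sup>2)
      + 1 / \<theta> * (\<Sum>b\<in>Basis. q powr (- m) * (norm (g b))\<^sup>2)"
    using \<theta> e by (intro add_right_mono mult_left_mono mult_right_mono) (auto simp: q_def)
  also have "q powr (m - 2 * \<alpha>) * q = q powr (- w)"
  proof -
    have "q powr (m - 2 * \<alpha>) * q = q powr (m - 2 * \<alpha> + 1)"
      using q0 by (simp add: powr_add)
    also have "m - 2 * \<alpha> + 1 = - w" using wm by simp
    finally show ?thesis .
  qed
  finally show ?thesis unfolding q_def .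
qed

text \<open>The common source of all later estimates. Hardy takes \<open>\<alpha> = 1\<close>,
  \<open>w = 1\<close>, \<open>m = 0\<close>; Rellich takes \<open>\<alpha> = 2\<close>,
  \<open>w = 2\<close>, \<open>m = 1\<close>; the pointwise bound takes \<open>\<alpha>\<close> half
  the dimension and \<open>w = m\<close>, so that the first term on the left vanishes.\<close>

lemma (in smooth_supported) radial_inequality:
  fixes \<alpha> :: real
  assumes q: "\<forall>x\<in>K. 0 < (norm (x - a))\<^sup>2 + e"
    and e: "0 \<le> e" and \<theta>: "0 < \<theta>" and wm: "w + m = 2 * \<alpha> - 1"
  shows "\<bar>(DIM('a) - 2 * \<alpha>) * weighted_L2 a e \<alpha> v + 2 * \<alpha> * e * weighted_L2 a e (\<alpha> + 1) v\<bar>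
    \<le> \<theta> * weighted_L2 a e w v + 1 / \<theta> * (\<Sum>b\<in>Basis. weighted_L2 a e m (dir_deriv v b))"
proof -
  let ?q = "\<lambda>x. (norm (x - a))\<^sup>2 + e"
  let ?R = "\<lambda>x. 2 * ?q x powr (- \<alpha>) * (\<Sum>b\<in>Basis. ((x - a) \<bullet> b) * (v x \<bullet> dir_deriv v b x))"
  let ?T = "\<lambda>x. \<theta> * (?q x powr (- w) * (norm (v x))\<^sup>2)
      + 1 / \<theta> * (\<Sum>b\<in>Basis. ?q x powr (- m) * (norm (dir_deriv v b x))\<^sup>2)"
  have I: "integrable lborel (\<lambda>x. ?q x powr s * (norm (v x))\<^sup>2)"
    "integrable lborel (\<lambda>x. ?q x powr s * (norm (dir_deriv v b x))\<^sup>2)" for s b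
    using integrable_weighted_L2[OF q] smooth_supported.integrable_weighted_L2[OF dir_deriv_supported q]
    by blast+
  have "\<bar>integral\<^sup>L lborel ?R\<bar> \<le> (LINT x|lborel. \<bar>?R x\<bar>)"
    by (rule integral_abs_bound)
  also have "\<dots> \<le> integral\<^sup>L lborel ?T"
  proof (rule integral_mono)
    show "integrable lborel (\<lambda>x. \<bar>?R x\<bar>)"
      using radial_identity(1)[OF q] by (rule integrable_abs)
    show "integrable lborel ?T"
      by (intro Bochner_Integration.integrable_add integrable_mult_right
          Bochner_Integration.integrable_sum I)
    show "\<bar>?R x\<bar> \<le> ?T x" for x
    proof (cases "x \<in> K")
      case True
      then show ?thesis using q by (intro radial_term_bound e \<theta> wm) auto
    qed (simp add: outside dir_deriv_outside)
  qed
  also have "\<dots> = \<theta> * weighted_L2 a e w v + 1 / \<theta> * (\<Sum>b\<in>Basis. weighted_L2 a e m (dir_deriv v b))"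
    unfolding weighted_L2_def using I by simp
  finally show ?thesis unfolding radial_identity(2)[OF q] by simp
qed

section \<open>Recovering point values from concentrated weights\<close>

text \<open>On a small ball of radius r about \<open>a\<close>, the squared norm of \<open>v\<close>
  is at least half its value at \<open>a\<close>. With \<open>e\<close> equal to the square of r,
  the weight there is at least a constant times the power -d-2 of r; the factor \<open>e\<close> and
  the volume of the ball cancel this power, so the constant does not depend on r.\<close>

lemma (in smooth_supported) norm_sq_le_concentrated:
  assumes B: "\<And>e. 0 < e \<Longrightarrow> e * weighted_L2 a e (DIM('a) / 2 + 1) v \<le> B"
  shows "(norm (v a))\<^sup>2 \<le> 2 powr (DIM('a) / 2 + 2) / unit_ball_vol (DIM('a)) * B"
proof (cases "v a = 0")
  case True
  \<comment> \<open>If \<open>v a = 0\<close> only \<open>0 \<le> B\<close> remains to be shown, and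
    any positive \<open>e\<close> gives it.\<close>
  have "0 \<le> 1 * weighted_L2 a 1 (DIM('a) / 2 + 1) v" by (simp add: weighted_L2_nonneg)
  also have "\<dots> \<le> B" by (rule B) simp
  finally show ?thesis using True by simp
next
  case False
  let ?n = "(norm (v a))\<^sup>2" and ?d = "real DIM('a)"
  have "continuous_on UNIV (\<lambda>x. (norm (v x))\<^sup>2)"
    by (intro continuous_intros)
  moreover have "0 < ?n / 2" using False by simp
  ultimately obtain r where r: "0 < r" "\<And>x. dist x a < r \<Longrightarrow> dist ((norm (v x))\<^sup>2) ?n < ?n / 2"
    unfolding continuous_on_iff by (metis UNIV_I)
  have ge: "?n / 2 \<le> (norm (v x))\<^sup>2" if "x \<in> ball a r" for x
    using r(2)[of x] that by (auto simp: dist_real_def dist_commute abs_if split: if_splits)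
  \<comment> \<open>A lower bound for the integrand on the ball: the base of the power is at most
    \<open>2 * r\<^sup>2\<close> there, and the exponent is negative.\<close>
  define c where "c = (2 * r\<^sup>2) powr (- (?d / 2 + 1)) * (?n / 2)"
  have c: "indicator (ball a r) x * c
      \<le> ((norm (x - a))\<^sup>2 + r\<^sup>2) powr (- (?d / 2 + 1)) * (norm (v x))\<^sup>2" for x
  proof (cases "x \<in> ball a r")
    case True
    then have "(norm (x - a))\<^sup>2 + r\<^sup>2 \<le> 2 * r\<^sup>2"
      by (simp add: dist_norm norm_minus_commute power_mono)
    then have "(2 * r\<^sup>2) powr (- (?d / 2 + 1)) \<le> ((norm (x - a))\<^sup>2 + r\<^sup>2) powr (- (?d / 2 + 1))"
      using r(1) by (intro powr_mono2') (auto simp: add_nonneg_pos)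
    then have "c \<le> ((norm (x - a))\<^sup>2 + r\<^sup>2) powr (- (?d / 2 + 1)) * (norm (v x))\<^sup>2"
      unfolding c_def using ge[OF True] by (intro mult_mono) auto
    then show ?thesis using True by simp
  qed simp
  have "c * measure lborel (ball a r) = (LINT x|lborel. indicator (ball a r) x * c)"
    by simp
  also have "\<dots> \<le> weighted_L2 a (r\<^sup>2) (?d / 2 + 1) v"
    unfolding weighted_L2_def
  proof (rule integral_mono[OF _ _ c])
    show "integrable lborel (\<lambda>x. ((norm (x - a))\<^sup>2 + r\<^sup>2) powr (- (?d / 2 + 1)) * (norm (v x))\<^sup>2)"
      using r(1) by (intro integrable_weighted_L2) (simp add: add_nonneg_pos)
    show "integrable lborel (\<lambda>x. indicator (ball a r) x * c)"
      using emeasure_lborel_ball_finite[of a r]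
      by (intro integrable_mult_left integrable_real_indicator) auto
  qed
  finally have "r\<^sup>2 * (c * measure lborel (ball a r)) \<le> r\<^sup>2 * weighted_L2 a (r\<^sup>2) (?d / 2 + 1) v"
    by (intro mult_left_mono) auto
  also have "\<dots> \<le> B" using r(1) by (intro B) simp
  finally have "r\<^sup>2 * (c * measure lborel (ball a r)) \<le> B" .
  moreover have "r\<^sup>2 * (c * measure lborel (ball a r)) = ?n * unit_ball_vol ?d / 2 powr (?d / 2 + 2)"
  proof -
    have "(2 * r\<^sup>2) powr (- (?d / 2 + 1)) = 2 powr (- (?d / 2 + 1)) * (r powr 2) powr (- (?d / 2 + 1))"
      using r(1) by (simp add: powr_mult)
    also have "(r powr 2) powr (- (?d / 2 + 1)) = r powr (- 2 - ?d)"
      by (simp add: powr_powr algebra_simps)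
    finally have "c = 2 powr (- (?d / 2 + 1)) / 2 * r powr (- 2 - ?d) * ?n"
      by (simp add: c_def)
    moreover have "2 powr (- (?d / 2 + 1)) / 2 = 1 / (2::real) powr (?d / 2 + 2)"
      using powr_add[of 2 "?d / 2 + 1" 1] powr_minus_divide[of 2 "?d / 2 + 1"] by (simp add: add.assoc)
    moreover have "measure lborel (ball a r) = unit_ball_vol ?d * r powr ?d"
      using r(1) by (simp add: content_ball powr_realpow)
    moreover have "r\<^sup>2 = r powr 2" using r(1) by simp
    ultimately have "r\<^sup>2 * (c * measure lborel (ball a r))
        = (r powr 2 * r powr (- 2 - ?d) * r powr ?d) * (?n * unit_ball_vol ?d / 2 powr (?d / 2 + 2))"
      by (simp only: times_divide_eq_left times_divide_eq_right mult_1 mult_ac)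
    also have "r powr 2 * r powr (- 2 - ?d) * r powr ?d = 1"
      using r(1) unfolding powr_add[symmetric] by simp
    finally show ?thesis by simp
  qed
  ultimately have "?n * unit_ball_vol ?d / 2 powr (?d / 2 + 2) \<le> B" by simp
  moreover have "0 < unit_ball_vol ?d" by simp
  ultimately show ?thesis by (simp add: field_simps)
qed

section \<open>Hessian, Laplacian and gradient\<close>

context smooth_supported
begin

lemma integral_dir_deriv_inner:
  assumes w: "smooth_supported w K"
  shows "(LINT x|lborel. dir_deriv v b x \<bullet> w x) = - (LINT x|lborel. v x \<bullet> dir_deriv w b x)"
proof -
  have "(LINT x|lborel. 0 * (v x \<bullet> w x) + 1 * (dir_deriv v b x \<bullet> w x + v x \<bullet> dir_deriv w b x)) = 0"
    by (rule integration_by_parts[OF smooth smooth_supported.smooth[OF w] compact, where S = UNIV])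
       (auto simp: outside)
  then show ?thesis
    using integrable_inner[OF smooth_supported.dir_deriv_supported[OF w]]
      smooth_supported.integrable_inner[OF dir_deriv_supported w] by simp
qed

lemma second_deriv_supported: "smooth_supported (dir_deriv (dir_deriv v b) c) K"
  by (rule smooth_supported.dir_deriv_supported[OF dir_deriv_supported])

text \<open>One derivative in direction \<open>b\<close> is moved to the second factor and one in
  direction \<open>c\<close> to the first. The two signs cancel, and commuting derivatives makes
  both factors the same mixed derivative.\<close>

lemma integral_second_derivs_eq:
  "(LINT x|lborel. dir_deriv (dir_deriv v b) b x \<bullet> dir_deriv (dir_deriv v c) c x)
    = (LINT x|lborel. (norm (dir_deriv (dir_deriv v b) c x))\<^sup>2)"
proof -
  let ?X = "dir_deriv (dir_deriv v b) c"
  note sup = dir_deriv_supported second_deriv_supported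
  have X: "dir_deriv (dir_deriv v c) b = ?X" and
    Y: "dir_deriv (dir_deriv (dir_deriv v c) c) b = dir_deriv (dir_deriv (dir_deriv v c) b) c"
    by (intro smooth_dir_deriv_commute smooth smooth_dir_deriv)+
  have "(LINT x|lborel. dir_deriv (dir_deriv v b) b x \<bullet> dir_deriv (dir_deriv v c) c x)
      = - (LINT x|lborel. dir_deriv v b x \<bullet> dir_deriv ?X c x)"
    by (simp only: smooth_supported.integral_dir_deriv_inner[OF sup] Y X)
  also have "\<dots> = (LINT x|lborel. ?X x \<bullet> ?X x)"
    by (simp only: smooth_supported.integral_dir_deriv_inner[OF sup])
  finally show ?thesis by (simp add: power2_norm_eq_inner)
qed

lemma integral_hessian:
  "(\<Sum>b\<in>Basis. \<Sum>c\<in>Basis. LINT x|lborel. (norm (dir_deriv (dir_deriv v b) c x))\<^sup>2)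
    = (LINT x|lborel. (norm (\<Sum>b\<in>Basis. dir_deriv (dir_deriv v b) b x))\<^sup>2)"
proof -
  have I: "integrable lborel (\<lambda>x. dir_deriv (dir_deriv v b) b x \<bullet> dir_deriv (dir_deriv v c) c x)" for b c
    by (intro smooth_supported.integrable_inner[OF second_deriv_supported second_deriv_supported])
  show ?thesis
    unfolding power2_norm_eq_inner inner_sum_left inner_sum_right
    using I by (subst sum.swap) (simp add: integral_second_derivs_eq power2_norm_eq_inner)
qed

lemma integrable_laplacian_sq:
  "integrable lborel (\<lambda>x. (norm (\<Sum>b\<in>Basis. dir_deriv (dir_deriv v b) b x))\<^sup>2)"
  unfolding power2_norm_eq_inner inner_sum_left inner_sum_right
  by (intro Bochner_Integration.integrable_sum 
      smooth_supported.integrable_inner[OF second_deriv_supported second_deriv_supported])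

text \<open>Integration by parts turns the gradient integral into that of minus \<open>v\<close>
  times its Laplacian, and Young's inequality with parameter \<open>\<delta>\<close> separates the
  two factors.\<close>

lemma integral_gradient_le:
  assumes \<delta>: "0 < \<delta>"
  shows "(\<Sum>b\<in>Basis. LINT x|lborel. (norm (dir_deriv v b x))\<^sup>2)
    \<le> \<delta> * (LINT x|lborel. (norm (\<Sum>b\<in>Basis. dir_deriv (dir_deriv v b) b x))\<^sup>2)
      + 1 / (4 * \<delta>) * (LINT x|lborel. (norm (v x))\<^sup>2)"
proof -
  let ?L = "\<lambda>x. \<Sum>b\<in>Basis. dir_deriv (dir_deriv v b) b x"
  have I: "integrable lborel (\<lambda>x. v x \<bullet> dir_deriv (dir_deriv v b) b x)" for b
    by (rule integrable_inner[OF second_deriv_supported])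
  have "(LINT x|lborel. (norm (dir_deriv v b x))\<^sup>2) = - (LINT x|lborel. v x \<bullet> dir_deriv (dir_deriv v b) b x)"
    for b
    unfolding power2_norm_eq_inner by (rule integral_dir_deriv_inner[OF dir_deriv_supported])
  then have "(\<Sum>b\<in>Basis. LINT x|lborel. (norm (dir_deriv v b x))\<^sup>2) = (LINT x|lborel. - (v x \<bullet> ?L x))"
    using I by (simp add: inner_sum_right sum_negf)
  also have "\<dots> \<le> (LINT x|lborel. \<delta> * (norm (?L x))\<^sup>2 + 1 / (4 * \<delta>) * (norm (v x))\<^sup>2)"
  proof (rule integral_mono)
    show "integrable lborel (\<lambda>x. - (v x \<bullet> ?L x))"
      using I by (simp add: inner_sum_right)
    show "integrable lborel (\<lambda>x. \<delta> * (norm (?L x))\<^sup>2 + 1 / (4 * \<delta>) * (norm (v x))\<^sup>2)"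
      by (intro Bochner_Integration.integrable_add integrable_mult_right
          integrable_laplacian_sq integrable_norm_sq)
    fix x
    have "0 \<le> (2 * \<delta> * norm (?L x) - norm (v x))\<^sup>2 / (4 * \<delta>)" using \<delta> by simp
    also have "\<dots> = \<delta> * (norm (?L x))\<^sup>2 + 1 / (4 * \<delta>) * (norm (v x))\<^sup>2 - norm (v x) * norm (?L x)"
      using \<delta> by (simp add: power2_eq_square field_simps)
    finally show "- (v x \<bullet> ?L x) \<le> \<delta> * (norm (?L x))\<^sup>2 + 1 / (4 * \<delta>) * (norm (v x))\<^sup>2"
      using Cauchy_Schwarz_ineq2[of "v x" "?L x"] by linarith
  qed
  also have "\<dots> = \<delta> * (LINT x|lborel. (norm (?L x))\<^sup>2) + 1 / (4 * \<delta>) * (LINT x|lborel. (norm (v x))\<^sup>2)"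
    using integrable_laplacian_sq integrable_norm_sq by simp
  finally show ?thesis .
qed

section \<open>Hardy, Rellich and pointwise inequalities\<close>

text \<open>In both dimensions \<open>d - 2\<close> has absolute value 1. With
  \<open>\<theta> = 1/2\<close> half of the left side absorbs the weighted term on the right,
  leaving the factor 4.\<close>

lemma hardy_inequality:
  assumes d: "DIM('a) \<in> {1, 3}" and a: "a \<notin> K"
  shows "weighted_L2 a 0 1 v \<le> 4 * (\<Sum>b\<in>Basis. weighted_L2 a 0 0 (dir_deriv v b))"
proof -
  have q: "\<forall>x\<in>K. 0 < (norm (x - a))\<^sup>2 + 0" using a by auto
  have "\<bar>(real DIM('a) - 2) * weighted_L2 a 0 1 v\<bar>
      \<le> 1 / 2 * weighted_L2 a 0 1 v + 2 * (\<Sum>b\<in>Basis. weighted_L2 a 0 0 (dir_deriv v b))"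
    using radial_inequality[OF q, of "1/2" 1 0 1] by simp
  then show ?thesis using d weighted_L2_nonneg[of a 0 1 v] by auto
qed

lemma hardy_inequality_regularized:
  assumes d: "DIM('a) = 3" and e: "0 < e"
  shows "weighted_L2 a e 1 v \<le> 4 * (\<Sum>b\<in>Basis. LINT x|lborel. (norm (dir_deriv v b x))\<^sup>2)"
proof -
  have q: "\<forall>x\<in>K. 0 < (norm (x - a))\<^sup>2 + e" using e by (simp add: add_nonneg_pos)
  have "\<bar>weighted_L2 a e 1 v + 2 * e * weighted_L2 a e 2 v\<bar>
      \<le> 1 / 2 * weighted_L2 a e 1 v + 2 * (\<Sum>b\<in>Basis. weighted_L2 a e 0 (dir_deriv v b))"
    using radial_inequality[OF q, of "1/2" 1 0 1] d e by simp
  moreover have "0 \<le> e * weighted_L2 a e 2 v"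
    using e by (simp add: weighted_L2_nonneg)
  ultimately show ?thesis
    by (simp add: smooth_supported.weighted_L2_0[OF dir_deriv_supported q])
qed

text \<open>Here \<open>d - 4\<close> is -3 or -1, so absorption works as in
  \<open>hardy_inequality\<close> and costs a factor 4. Hardy for each partial derivative costs
  another 4, and \<open>integral_hessian\<close> turns the Hessian into the Laplacian.\<close>

lemma rellich_inequality:
  assumes d: "DIM('a) \<in> {1, 3}" and a: "a \<notin> K"
  shows "weighted_L2 a 0 2 v
    \<le> 16 * (LINT x|lborel. (norm (\<Sum>b\<in>Basis. dir_deriv (dir_deriv v b) b x))\<^sup>2)"
proof -
  have q: "\<forall>x\<in>K. 0 < (norm (x - a))\<^sup>2 + 0" using a by auto
  have "\<bar>(real DIM('a) - 4) * weighted_L2 a 0 2 v\<bar>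
      \<le> 1 / 2 * weighted_L2 a 0 2 v + 2 * (\<Sum>b\<in>Basis. weighted_L2 a 0 1 (dir_deriv v b))"
    using radial_inequality[OF q, of "1/2" 2 1 2] by simp
  then have "weighted_L2 a 0 2 v \<le> 4 * (\<Sum>b\<in>Basis. weighted_L2 a 0 1 (dir_deriv v b))"
    using d weighted_L2_nonneg[of a 0 2 v] by auto
  also have "\<dots> \<le> 4 * (\<Sum>b\<in>Basis. 4 * (\<Sum>c\<in>Basis. weighted_L2 a 0 0 (dir_deriv (dir_deriv v b) c)))"
    by (intro mult_left_mono sum_mono smooth_supported.hardy_inequality[OF dir_deriv_supported d a]) auto
  also have "\<dots> = 16 * (\<Sum>b\<in>Basis. \<Sum>c\<in>Basis. LINT x|lborel. (norm (dir_deriv (dir_deriv v b) c x))\<^sup>2)"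
    by (simp add: sum_distrib_left smooth_supported.weighted_L2_0[OF second_deriv_supported q])
  finally show ?thesis by (simp only: integral_hessian)
qed

text \<open>The parameter \<open>\<theta>\<close> makes the coefficient of the Laplacian as small as
  desired, at the price of a larger coefficient of the squared norm of \<open>v\<close>.\<close>

lemma norm_sq_le_integrals:
  assumes d: "DIM('a) \<in> {1, 3}" and \<theta>: "1 \<le> \<theta>"
  shows "(norm (v a))\<^sup>2 \<le> 2 powr (DIM('a) / 2 + 2) / unit_ball_vol (DIM('a)) *
    (8 / \<theta> * (LINT x|lborel. (norm (\<Sum>b\<in>Basis. dir_deriv (dir_deriv v b) b x))\<^sup>2)
      + (\<theta> ^ 3 + 1) * (LINT x|lborel. (norm (v x))\<^sup>2))"
proof (rule norm_sq_le_concentrated)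
  define L where "L = (LINT x|lborel. (norm (\<Sum>b\<in>Basis. dir_deriv (dir_deriv v b) b x))\<^sup>2)"
  define N where "N = (LINT x|lborel. (norm (v x))\<^sup>2)"
  define G where "G = (\<Sum>b\<in>Basis. LINT x|lborel. (norm (dir_deriv v b x))\<^sup>2)"
  have nonneg: "0 \<le> L" "0 \<le> N" "0 \<le> G"
    by (auto simp: L_def N_def G_def intro!: sum_nonneg)
  \<comment> \<open>Interpolation with \<open>\<delta> = 1 / \<theta>\<^sup>2\<close>: after
    multiplication by \<open>4 * \<theta>\<close> the Laplacian still carries a factor of order
    \<open>1 / \<theta>\<close>.\<close>
  have "G \<le> 1 / \<theta>\<^sup>2 * L + 1 / (4 * (1 / \<theta>\<^sup>2)) * N"
    unfolding L_def N_def G_def by (rule integral_gradient_le) (use \<theta> in simp)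
  then have "4 * \<theta> * G \<le> 4 * \<theta> * (1 / \<theta>\<^sup>2 * L + 1 / (4 * (1 / \<theta>\<^sup>2)) * N)"
    using \<theta> by (intro mult_left_mono) auto
  also have "\<dots> = 4 / \<theta> * L + \<theta> ^ 3 * N"
    using \<theta> by (simp add: field_simps power2_eq_square power3_eq_cube)
  finally have G: "4 * \<theta> * G \<le> 4 / \<theta> * L + \<theta> ^ 3 * N" .
  fix e :: real assume e: "0 < e"
  then have q: "\<forall>x\<in>K. 0 < (norm (x - a))\<^sup>2 + e" by (simp add: add_nonneg_pos)
  let ?W = "weighted_L2 a e (DIM('a) / 2 + 1) v"
  have "e * ?W \<le> 4 / \<theta> * L + 4 * \<theta> * G + N"
  proof (cases "DIM('a) = 1")
    case True
    \<comment> \<open>In dimension 1 both exponents \<open>w\<close> and \<open>m\<close> are 0, so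
      no Hardy inequality enters.\<close>
    have "\<bar>e * ?W\<bar> \<le> N + G"
      using radial_inequality[OF q, of 1 0 0 "1/2"] e True
      by (simp add: N_def G_def weighted_L2_0[OF q]
          smooth_supported.weighted_L2_0[OF dir_deriv_supported q])
    moreover have "1 * G \<le> 4 * \<theta> * G" using \<theta> nonneg by (intro mult_right_mono) auto
    moreover have "0 \<le> 4 / \<theta> * L" using \<theta> nonneg by simp
    ultimately show ?thesis by linarith
  next
    case False
    with d have d3: "DIM('a) = 3" by simp
    \<comment> \<open>In dimension 3 both exponents are 1. Regularized Hardy is applied to
      \<open>v\<close> and to each partial derivative, giving \<open>4 * G\<close> and, through the
      Hessian, \<open>4 * L\<close>.\<close>
    have "\<bar>3 * e * ?W\<bar> \<le> \<theta> * weighted_L2 a e 1 v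
        + 1 / \<theta> * (\<Sum>b\<in>Basis. weighted_L2 a e 1 (dir_deriv v b))"
      using radial_inequality[OF q, of \<theta> 1 1 "3/2"] e \<theta> d3 by simp
    also have "\<dots> \<le> \<theta> * (4 * G) + 1 / \<theta> * (4 * L)"
    proof (intro add_mono mult_left_mono)
      show "weighted_L2 a e 1 v \<le> 4 * G"
        unfolding G_def by (rule hardy_inequality_regularized[OF d3 e])
      have "(\<Sum>b\<in>Basis. weighted_L2 a e 1 (dir_deriv v b))
          \<le> (\<Sum>b\<in>Basis. 4 * (\<Sum>c\<in>Basis. LINT x|lborel. (norm (dir_deriv (dir_deriv v b) c x))\<^sup>2))"
        by (intro sum_mono smooth_supported.hardy_inequality_regularized[OF dir_deriv_supported d3 e])
      also have "\<dots> = 4 * L"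
        unfolding L_def integral_hessian[symmetric] by (simp add: sum_distrib_left)
      finally show "(\<Sum>b\<in>Basis. weighted_L2 a e 1 (dir_deriv v b)) \<le> 4 * L" .
    qed (use \<theta> in auto)
    moreover have "0 \<le> e * ?W" using e by (simp add: weighted_L2_nonneg)
    ultimately show ?thesis using nonneg by simp
  qed
  moreover have "8 / \<theta> * L = 4 / \<theta> * L + 4 / \<theta> * L" by simp
  moreover have "(\<theta> ^ 3 + 1) * N = \<theta> ^ 3 * N + N" by (simp add: algebra_simps)
  ultimately show "e * ?W \<le> 8 / \<theta> * L + (\<theta> ^ 3 + 1) * N"
    using G by linarith
qed

end

section \<open>From the supremum bound to the stated inequality\<close>

lemma Lp_term_le:
  fixes u :: "'a::euclidean_space \<Rightarrow> complex"
  assumes p: "1 < p" and M: "\<And>x. (cmod (u x))\<^sup>2 \<le> M"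
    and u: "integrable lborel (\<lambda>x. (cmod (u x))\<^sup>2)"
  shows "Lp_term p u \<le> M + (LINT x|lborel. (cmod (u x))\<^sup>2)"
proof -
  define N where "N = (LINT x|lborel. (cmod (u x))\<^sup>2)"
  have N: "0 \<le> N" by (simp add: N_def)
  have M0: "0 \<le> M" using M[of undefined] zero_le_power2 order_trans by blast
  show ?thesis
  proof (cases "p = \<infinity>")
    case True
    have "(SUP x. (cmod (u x))\<^sup>2) \<le> M" using M by (intro cSUP_least) auto
    then show ?thesis using True N unfolding N_def[symmetric] by (simp add: Lp_term_def)
  next
    case False
    then obtain r where r: "p = ereal r" "1 < r" using p by (cases p) auto
    have pw: "cmod (u x) powr (2 * r) \<le> M powr (r - 1) * (cmod (u x))\<^sup>2" for x
    proof (cases "u x = 0")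
      case False
      have "cmod (u x) powr (2 * r) = ((cmod (u x))\<^sup>2) powr (r - 1) * ((cmod (u x))\<^sup>2) powr 1"
        using False by (simp add: powr_powr flip: powr_add powr_numeral)
      also have "\<dots> \<le> M powr (r - 1) * (cmod (u x))\<^sup>2"
        using r M[of x] by (simp add: mult_right_mono powr_mono2)
      finally show ?thesis .
    qed simp
    have "(LINT x|lborel. cmod (u x) powr (2 * r)) \<le> (LINT x|lborel. M powr (r - 1) * (cmod (u x))\<^sup>2)"
      \<comment> \<open>Integrability is supplied for the majorant. A nonintegrable left side would
        have the default integral 0, which the nonnegative majorant also dominates.\<close>
      using pw u by (intro integral_mono') auto
    also have "\<dots> = M powr (r - 1) * N" by (simp add: N_def)
    \<comment> \<open>Both bases are enlarged to \<open>M + N\<close> so that taking the root of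
      order \<open>r\<close> yields exactly \<open>M + N\<close>.\<close>
    also have "\<dots> \<le> (M + N) powr (r - 1) * (M + N) powr 1"
      using r M0 N by (intro mult_mono powr_mono2) auto
    also have "\<dots> = (M + N) powr r" unfolding powr_add[symmetric] by simp
    finally have "(LINT x|lborel. cmod (u x) powr (2 * r)) powr (1 / r) \<le> ((M + N) powr r) powr (1 / r)"
      using r by (intro powr_mono2) auto
    also have "\<dots> = M + N" using r M0 N by (simp add: powr_powr)
    finally show ?thesis using r by (simp add: Lp_term_def N_def)
  qed
qed

theorem corollary2p4:
  fixes p :: ereal
  assumes "DIM('a::euclidean_space) \<in> {1, 3}" and "1 < p" and "p \<le> \<infinity>"
  shows "\<exists>D1 D2 :: real. D1 > 0 \<and> D2 > 0 \<and>
    (\<forall>u \<in> test_functions (UNIV - {0 :: 'a}).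
      Lp_term p u \<le>
        (LINT x|lborel. (cmod (laplacian u x))\<^sup>2
           - D1 * ((cmod (u x))\<^sup>2 / norm x ^ 4) + D2 * (cmod (u x))\<^sup>2))"
proof -
  define c where "c = 2 powr (DIM('a) / 2 + 2) / unit_ball_vol (DIM('a))"
  have c: "0 < c" by (simp add: c_def)
  \<comment> \<open>The bound \<open>16 * c \<le> \<theta>\<close> makes the Laplacian coefficient
    \<open>8 * c / \<theta>\<close> in the pointwise estimate at most one half.\<close>
  define \<theta> where "\<theta> = max 1 (16 * c)"
  define C where "C = c * (\<theta> ^ 3 + 1)"
  have \<theta>: "1 \<le> \<theta>" "16 * c \<le> \<theta>" by (auto simp: \<theta>_def)
  have C: "0 < C" using c \<theta> by (simp add: C_def add_nonneg_pos)
  \<comment> \<open>Half of the Laplacian integral is spent on the supremum. By Rellich with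
    constant 16, the other half pays for 1/32 of the singular term. In \<open>C + 1\<close>, the
    \<open>C\<close> comes from the pointwise bound and the 1 from
    \<open>Lp_term_le\<close>.\<close>
  have "Lp_term p u \<le> (LINT x|lborel. (cmod (laplacian u x))\<^sup>2
      - 1 / 32 * ((cmod (u x))\<^sup>2 / norm x ^ 4) + (C + 1) * (cmod (u x))\<^sup>2)"
    if "u \<in> test_functions (UNIV - {0 :: 'a})" for u
  proof -
    define K where "K = closure (support_on UNIV u)"
    have "smooth u" "compact K" "0 \<notin> K"
      using that by (auto simp: test_functions_def K_def)
    moreover have "u x = 0" if "x \<notin> K" for x
      using that closure_subset[of "support_on UNIV u"] by (auto simp: K_def support_on_def)
    ultimately interpret smooth_supported u K by unfold_locales
    have lap: "laplacian u = (\<lambda>x. \<Sum>b\<in>Basis. dir_deriv (dir_deriv u b) b x)"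
      by (simp add: laplacian_def fun_eq_iff)
    define L where "L = (LINT x|lborel. (cmod (laplacian u x))\<^sup>2)"
    define N where "N = (LINT x|lborel. (cmod (u x))\<^sup>2)"
    define R where "R = (LINT x|lborel. (cmod (u x))\<^sup>2 / norm x ^ 4)"
    have nonneg: "0 \<le> L" "0 \<le> N" by (auto simp: L_def N_def)
    \<comment> \<open>At the origin both sides are 0, because \<open>u\<close> vanishes
      there.\<close>
    have weight: "((norm (x - 0))\<^sup>2 + 0) powr (- 2) * (cmod (u x))\<^sup>2 = (cmod (u x))\<^sup>2 / norm x ^ 4"
      for x
      using \<open>0 \<notin> K\<close> outside[of 0]
      by (cases "x = 0") (simp_all add: powr_minus field_simps flip: power_mult)
    have "\<forall>x\<in>K. 0 < (norm (x - 0))\<^sup>2 + 0" using \<open>0 \<notin> K\<close> by auto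
    from integrable_weighted_L2[OF this, of "- 2"]
    have R_int: "integrable lborel (\<lambda>x. (cmod (u x))\<^sup>2 / norm x ^ 4)"
      unfolding weight .
    have R: "R \<le> 16 * L"
      using rellich_inequality[OF assms(1) \<open>0 \<notin> K\<close>]
      unfolding weighted_L2_def weight L_def R_def lap .
    have "(cmod (u x))\<^sup>2 \<le> L / 2 + C * N" for x
    proof -
      have "(cmod (u x))\<^sup>2 \<le> c * (8 / \<theta> * L + (\<theta> ^ 3 + 1) * N)"
        using norm_sq_le_integrals[OF assms(1) \<theta>(1), of x] unfolding c_def L_def N_def lap .
      also have "\<dots> = 8 * c / \<theta> * L + C * N" by (simp add: C_def algebra_simps)
      also have "8 * c / \<theta> \<le> 1 / 2" using \<theta> by (simp add: field_simps)
      then have "8 * c / \<theta> * L + C * N \<le> 1 / 2 * L + C * N"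
        using nonneg by (intro add_right_mono mult_right_mono)
      finally show ?thesis by simp
    qed
    from Lp_term_le[OF assms(2) this integrable_norm_sq]
    have "Lp_term p u \<le> L / 2 + C * N + N" by (simp add: N_def)
    also have "\<dots> \<le> L - 1 / 32 * R + (C + 1) * N"
      using R by (simp add: algebra_simps)
    also have "\<dots> = (LINT x|lborel. (cmod (laplacian u x))\<^sup>2
        - 1 / 32 * ((cmod (u x))\<^sup>2 / norm x ^ 4) + (C + 1) * (cmod (u x))\<^sup>2)"
    proof -
      have "(LINT x|lborel. f x - 1 / 32 * g x + (C + 1) * h x)
          = integral\<^sup>L lborel f - 1 / 32 * integral\<^sup>L lborel g + (C + 1) * integral\<^sup>L lborel h"
        if "integrable lborel f" "integrable lborel g" "integrable lborel h" for f g h :: "'a \<Rightarrow> real"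
        using that by simp
      from this[OF integrable_laplacian_sq R_int integrable_norm_sq]
      show ?thesis by (simp only: L_def R_def N_def lap)
    qed
    finally show ?thesis .
  qed
  then show ?thesis
    using C by (intro exI[of _ "1 / 32"] exI[of _ "C + 1"]) auto
qed

end
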